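(* If a quadratic stochastic operator $V:S^{m-1}\to S^{m-1}$ is both dissipative and Volterra, then $V$ is the identity operator on $S^{m-1}$.
   Context: $S^{m-1}=\{x\in\mathbb{R}^m: x_i\ge 0,\ \sum_{i=1}^m x_i=1\}$. A quadratic stochastic operator (q.s.o.) is a map $V:S^{m-1}\to S^{m-1}$ of the form $(Vx)_k=\sum_{i,j=1}^m p_{ij,k}x_ix_j$, $k=1,\dots,m$, where $p_{ij,k}=p_{ji,k}\ge 0$ and $\sum_{k=1}^m p_{ij,k}=1$ for all $i,j$. It is called Volterra if $p_{ij,k}=0$ for all $i,j$ and all $k\notin\{i,j\}$. For $x\in\mathbb{R}^m$, let $x_{[1]}\ge\cdots\ge x_{[m]}$ denote the coordinates of $x$ in decreasing order. For $x,y\in\mathbb{R}^m$, write $x\prec y$ (equivalently $y\succ x$) if $\sum_{i=1}^k x_{[i]}\le\sum_{i=1}^k y_{[i]}$ for $k=1,\dots,m-1$ and $\sum_{i=1}^m x_{[i]}=\sum_{i=1}^m y_{[i]}$. $V$ is dissipative if $Vx\succ x$ for all $x\in S^{m-1}$. *)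

theory Defs
  imports "HOL-Analysis.Analysis" "HOL-Library.Multiset"
begin

definition prob_simplex :: "(real ^ 'm) set" where
  "prob_simplex = {x. (\<forall>i. 0 \<le> x $ i) \<and> (\<Sum>i\<in>UNIV. x $ i) = 1}"

text \<open>The argument \<open>p i j k\<close> is the coefficient $p_{ij,k}$.\<close>

definition qso_coeffs :: "('m::finite \<Rightarrow> 'm \<Rightarrow> 'm \<Rightarrow> real) \<Rightarrow> bool" where
  "qso_coeffs p \<longleftrightarrow>
     (\<forall>i j k. p i j k = p j i k \<and> 0 \<le> p i j k) \<and> (\<forall>i j. (\<Sum>k\<in>UNIV. p i j k) = 1)"

text \<open>Operators are total functions of which only the values on the simplex are constrained.\<close>

definition qso_with_coeffs ::
  "('m::finite \<Rightarrow> 'm \<Rightarrow> 'm \<Rightarrow> real) \<Rightarrow> (real ^ 'm \<Rightarrow> real ^ 'm) \<Rightarrow> bool" where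
  "qso_with_coeffs p V \<longleftrightarrow>
     qso_coeffs p \<and> V \<in> prob_simplex \<rightarrow> prob_simplex \<and>
     (\<forall>x\<in>prob_simplex. \<forall>k. V x $ k = (\<Sum>i\<in>UNIV. \<Sum>j\<in>UNIV. p i j k * x $ i * x $ j))"

definition quadratic_stochastic_operator :: "(real ^ 'm::finite \<Rightarrow> real ^ 'm) \<Rightarrow> bool" where
  "quadratic_stochastic_operator V \<longleftrightarrow> (\<exists>p. qso_with_coeffs p V)"

text \<open>The symmetric coefficients of a quadratic stochastic operator are determined by its values
  on the simplex, so the existential quantifier below speaks about \<^emph>\<open>the\<close> coefficients.\<close>

definition volterra :: "(real ^ 'm::finite \<Rightarrow> real ^ 'm) \<Rightarrow> bool" where
  "volterra V \<longleftrightarrow>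
     (\<exists>p. qso_with_coeffs p V \<and> (\<forall>i j k. k \<notin> {i, j} \<longrightarrow> p i j k = 0))"

text \<open>\<open>decr_coord x i\<close> is $x_{[i]}$, with the one-based index \<open>i\<close> ranging over
  \<open>{1..CARD('m)}\<close>; coordinates are sorted with multiplicity.\<close>

definition decr_coord :: "real ^ 'm::finite \<Rightarrow> nat \<Rightarrow> real" where
  "decr_coord x i =
     rev (sorted_list_of_multiset (image_mset (\<lambda>j. x $ j) (mset_set UNIV))) ! (i - 1)"

definition majorized_by :: "real ^ 'm::finite \<Rightarrow> real ^ 'm \<Rightarrow> bool" where
  "majorized_by x y \<longleftrightarrow>
     (\<forall>k\<in>{1..CARD('m) - 1}. (\<Sum>i=1..k. decr_coord x i) \<le> (\<Sum>i=1..k. decr_coord y i)) \<and>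
     (\<Sum>i=1..CARD('m). decr_coord x i) = (\<Sum>i=1..CARD('m). decr_coord y i)"

definition dissipative :: "(real ^ 'm::finite \<Rightarrow> real ^ 'm) \<Rightarrow> bool" where
  "dissipative V \<longleftrightarrow> (\<forall>x\<in>prob_simplex. majorized_by x (V x))"

end

(* Test V on the points (3/4) e_i + (1/4) e_j.  For a Volterra operator only the coordinates i and j
   of the image can be nonzero, the j-th one is at most 7/16, and the i-th one is
   at most 9/16 + (3/8) p_{ij,i}.  Since dissipativity forbids the largest coordinate to drop
   below 3/4, p_{ij,i} >= 1/2.  Exchanging i and j and using p_{ij,i} + p_{ij,j} = 1 forces equality,
   and the operator with these coefficients is the identity. *)
theory Submission
  imports Defs
begin

text \<open>Reversal brings the last entry of an increasingly sorted list, its maximum, to position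
  \<open>1 - 1 = 0\<close>.\<close>

lemma decr_coord_1:
  fixes x :: "real ^ 'm::finite"
  shows "decr_coord x 1 = Max (range (($) x))"
proof -
  define M where "M = image_mset (($) x) (mset_set (UNIV :: 'm set))"
  define L where "L = sorted_list_of_multiset M"
  have set_L: "set L = range (($) x)"
    by (simp add: L_def M_def)
  then have ne: "L \<noteq> []"
    by auto
  have "Max (set L) = last L"
  proof (intro Max_eqI)
    fix y assume "y \<in> set L"
    then show "y \<le> last L"
      using sorted_append[of "butlast L" "[last L]"] ne append_butlast_last_id[OF ne]
        sorted_sorted_list_of_multiset[of M, folded L_def]
      by (metis Un_iff empty_iff insert_iff list.set order_refl set_append)
  qed (use ne in auto)
  moreover have "decr_coord x 1 = rev L ! 0"
    by (simp add: decr_coord_def L_def M_def)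
  moreover have "rev L ! 0 = last L"
    using ne by (metis hd_conv_nth hd_rev rev_is_Nil_conv)
  ultimately show ?thesis
    using set_L by simp
qed

text \<open>Comes from the first majorization inequality, which compares the largest coordinates;
  \<open>k\<close> is a place where \<open>y\<close> attains its maximum. The dimension bound
  ensures that 1 lies in the range of partial sums.\<close>

lemma majorized_by_imp_le_coord:
  fixes x y :: "real ^ 'm::finite"
  assumes "majorized_by x y" and "2 \<le> CARD('m)"
  obtains k where "\<And>i. x $ i \<le> y $ k"
proof -
  have "(1::nat) \<in> {1..CARD('m) - 1}"
    using assms(2) by simp
  with assms(1) have "(\<Sum>i=1..1. decr_coord x i) \<le> (\<Sum>i=1..1. decr_coord y i)"
    unfolding majorized_by_def by blast
  then have le: "Max (range (($) x)) \<le> Max (range (($) y))"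
    by (simp add: decr_coord_1[unfolded One_nat_def])
  have "Max (range (($) y)) \<in> range (($) y)"
    by (intro Max_in) auto
  then obtain k where k: "Max (range (($) y)) = y $ k"
    by blast
  have "x $ i \<le> y $ k" for i
    using le k Max_ge[of "range (($) x)" "x $ i"] by auto
  then show thesis
    by (rule that)
qed

lemma qso_coeffs_le_1:
  assumes "qso_coeffs p"
  shows "p i j k \<le> 1"
proof -
  have "p i j k \<le> (\<Sum>k\<in>UNIV. p i j k)"
    using assms by (intro member_le_sum) (auto simp: qso_coeffs_def)
  with assms show ?thesis
    by (simp add: qso_coeffs_def)
qed

lemma volterra_coeffs_ge_half:
  fixes V :: "real ^ 'm::finite \<Rightarrow> real ^ 'm"
  assumes V: "qso_with_coeffs p V"
    and volt: "\<And>i j k. k \<notin> {i, j} \<Longrightarrow> p i j k = 0"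
    and diss: "dissipative V"
    and ij: "i \<noteq> j"
  shows "p i j i \<ge> 1 / 2"
proof -
  \<comment> \<open>With weights a and 1 - a, a coordinate of \<open>V x\<close> other than
    \<open>i\<close> is at most 1 - a^2. The choice a = 3/4 makes this smaller than a, so the
    maximum of \<open>V x\<close> must sit at \<open>i\<close>.\<close>
  define x :: "real ^ 'm" where
    "x = (\<chi> l. if l = i then 3 / 4 else if l = j then 1 / 4 else 0)"
  have x_sum: "(\<Sum>l\<in>UNIV. f l * x $ l) = f i * (3 / 4) + f j * (1 / 4)" for f
  proof -
    have "(\<Sum>l\<in>UNIV. f l * x $ l) = (\<Sum>l\<in>{i, j}. f l * x $ l)"
      by (intro sum.mono_neutral_right) (auto simp: x_def)
    then show ?thesis
      using ij by (simp add: x_def)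
  qed
  have x: "x \<in> prob_simplex"
    using x_sum[of "\<lambda>_. 1"] by (auto simp: prob_simplex_def x_def)
  have coeffs: "qso_coeffs p"
    using V by (simp add: qso_with_coeffs_def)
  then have sym: "p j i k = p i j k" for k
    by (simp add: qso_coeffs_def)
  have Vx: "V x $ k = 9 / 16 * p i i k + 3 / 8 * p i j k + 1 / 16 * p j j k" for k
  proof -
    \<comment> \<open>Regrouped so that \<open>x_sum\<close> applies to the inner and then to the
      outer sum.\<close>
    have "V x $ k = (\<Sum>l\<in>UNIV. (\<Sum>n\<in>UNIV. p l n k * x $ n) * x $ l)"
      using V x by (auto simp: qso_with_coeffs_def sum_distrib_left sum_distrib_right mult_ac)
    then show ?thesis
      unfolding x_sum sym by (simp add: field_simps)
  qed
  have "card {i, j} \<le> CARD('m)"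
    by (intro card_mono) auto
  then have "2 \<le> CARD('m)"
    using ij by simp
  moreover have "majorized_by x (V x)"
    using diss x by (simp add: dissipative_def)
  ultimately obtain k where "x $ i \<le> V x $ k"
    using majorized_by_imp_le_coord by metis
  then have ge: "3 / 4 \<le> 9 / 16 * p i i k + 3 / 8 * p i j k + 1 / 16 * p j j k"
    unfolding Vx by (simp add: x_def)
  note le1 = qso_coeffs_le_1[OF coeffs]
  \<comment> \<open>Otherwise the right-hand side of \<open>ge\<close> is at most 3/8 + 1/16 = 7/16
    < 3/4.\<close>
  have "k = i"
  proof (rule ccontr)
    assume "k \<noteq> i"
    then have "p i i k = 0"
      by (simp add: volt)
    then show False
      using ge le1[of i j k] le1[of j j k] by linarith
  qed
  moreover have "p j j i = 0"
    using ij by (simp add: volt)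
  ultimately show ?thesis
    using ge le1[of i i i] by simp
qed

theorem mainTheorem6:
  fixes V :: "real ^ 'm::finite \<Rightarrow> real ^ 'm"
  assumes "quadratic_stochastic_operator V"
    and "dissipative V"
    and "volterra V"
  shows "\<forall>x\<in>prob_simplex. V x = x"
proof
  fix x :: "real ^ 'm"
  assume x: "x \<in> prob_simplex"
  obtain p where V: "qso_with_coeffs p V" and volt: "\<And>i j k. k \<notin> {i, j} \<Longrightarrow> p i j k = 0"
    using assms(3) unfolding volterra_def by blast
  have coeffs: "qso_coeffs p"
    using V by (simp add: qso_with_coeffs_def)
  have sum_p: "(\<Sum>k\<in>{i, j}. p i j k) = 1" for i j
  proof -
    have "(\<Sum>k\<in>UNIV. p i j k) = (\<Sum>k\<in>{i, j}. p i j k)"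
      by (intro sum.mono_neutral_right) (auto simp: volt)
    then show ?thesis
      using coeffs by (simp add: qso_coeffs_def)
  qed
  \<comment> \<open>One formula for both cases: on the diagonal the two indicators add up to the
    value 1 at \<open>k = i\<close>. Being a sum of a term in \<open>i\<close> and a term in
    \<open>j\<close>, it lets the double sum factor below.\<close>
  have p: "p i j k = (of_bool (i = k) + of_bool (j = k)) / 2" for i j k
  proof (cases "i = j")
    case True
    then show ?thesis
      using sum_p[of i j] volt[of k i j] by auto
  next
    case False
    have "p i j i \<ge> 1 / 2" "p j i j \<ge> 1 / 2"
      using volterra_coeffs_ge_half[OF V volt assms(2)] False by metis+
    moreover have "p j i j = p i j j"
      using coeffs by (simp add: qso_coeffs_def)
    ultimately have "p i j i = 1 / 2" "p i j j = 1 / 2"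
      using sum_p[of i j] False by simp_all
    then show ?thesis
      using False volt[of k i j] by auto
  qed
  have sum_x: "(\<Sum>i\<in>UNIV. x $ i) = 1"
    using x by (simp add: prob_simplex_def)
  show "V x = x"
  proof (rule vec_eq_iff[THEN iffD2], rule allI)
    fix k
    have "V x $ k = (\<Sum>i\<in>UNIV. \<Sum>j\<in>UNIV. p i j k * x $ i * x $ j)"
      using V x by (simp add: qso_with_coeffs_def)
    also have "\<dots> = (\<Sum>i\<in>UNIV. \<Sum>j\<in>UNIV.
        (of_bool (i = k) * x $ i) * (x $ j / 2) + (x $ i / 2) * (of_bool (j = k) * x $ j))"
      by (intro sum.cong refl) (simp add: p field_simps)
    \<comment> \<open>Each product equals half of \<open>x $ k\<close>, since the coordinates of
      \<open>x\<close> sum to 1.\<close>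
    also have "\<dots> = (\<Sum>i\<in>UNIV. of_bool (i = k) * x $ i) * ((\<Sum>j\<in>UNIV. x $ j) / 2)
        + ((\<Sum>i\<in>UNIV. x $ i) / 2) * (\<Sum>j\<in>UNIV. of_bool (j = k) * x $ j)"
      by (simp only: sum.distrib sum_product sum_divide_distrib)
    also have "\<dots> = x $ k"
      by (simp add: sum_x of_bool_def if_distrib[of "\<lambda>c. c * _"] cong: if_cong)
    finally show "V x $ k = x $ k" .
  qed
qed

end
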